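(* Let $H$ be a real separable Hilbert space and let $R:H\to H$ be a bounded linear self-adjoint operator. For every bounded and uniformly continuous $f:H\to\mathbb{R}$ and every $t>0$, the mapping $x\mapsto S^R(t)f(x)$, where $$S^R(t)f(x):=\sup_{h\in H_R}\left\{\inf_{k\in H_R}\left\{f(x+k-h)+\frac{1}{2t}\|k\|_{H_R}^2\right\}-\frac{1}{t}\|h\|_{H_R}^2\right\},\qquad x\in H,$$ belongs to $\mathrm{BUC}(H)$.
   Context: $\mathrm{BUC}(H)$ is the space of bounded uniformly continuous functions from $H$ to $\mathbb{R}$. $H_R:=R(H)$, $R^{-1}:=(R_{|(\ker R)^\perp})^{-1}:H_R\to(\ker R)^\perp$ is the pseudo-inverse, and $H_R$ is a Hilbert space with norm $\|x\|_{H_R}:=\|R^{-1}x\|_H$. *)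

theory Defs
  imports "HOL-Analysis.Analysis"
begin

definition BUC :: "('a::metric_space \<Rightarrow> real) set" where
  "BUC = {f. bounded (range f) \<and> uniformly_continuous_on UNIV f}"

definition self_adjoint :: "('a::real_inner \<Rightarrow> 'a) \<Rightarrow> bool" where
  "self_adjoint R \<longleftrightarrow> (\<forall>x y. inner (R x) y = inner x (R y))"

definition kernel :: "('a::real_vector \<Rightarrow> 'b::real_vector) \<Rightarrow> 'a set" where
  "kernel R = {x. R x = 0}"

text \<open>For bounded linear \<open>R\<close> on a Hilbert space, \<open>R\<close> maps \<open>(kernel R)\<^sup>\<bottom>\<close>
  bijectively onto \<open>range R\<close>; the pseudo-inverse is only used on \<open>range R\<close>.\<close>

definition pseudo_inverse :: "('a::real_inner \<Rightarrow> 'a) \<Rightarrow> 'a \<Rightarrow> 'a" where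
  "pseudo_inverse R = the_inv_into ((kernel R)\<^sup>\<bottom>) R"

definition norm_R :: "('a::real_inner \<Rightarrow> 'a) \<Rightarrow> 'a \<Rightarrow> real" where
  "norm_R R x = norm (pseudo_inverse R x)"

text \<open>The supremum and infimum are taken in \<open>real\<close>. The lemmas below show that, for bounded
  \<open>f\<close> and \<open>t > 0\<close>, they range over (nonempty) sets bounded from the relevant side,
  so they agree with those in the extended reals.\<close>

definition lasry_lions ::
    "('a::real_inner \<Rightarrow> 'a) \<Rightarrow> real \<Rightarrow> ('a \<Rightarrow> real) \<Rightarrow> 'a \<Rightarrow> real" where
  "lasry_lions R t f x =
     (SUP h\<in>range R.
        (INF k\<in>range R. f (x + k - h) + 1 / (2 * t) * (norm_R R k)\<^sup>2)
        - 1 / t * (norm_R R h)\<^sup>2)"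

lemma lasry_lions_bdd_below:
  assumes "bounded (range f)" "t > 0"
  shows "bdd_below ((\<lambda>k. f (x + k - h) + 1 / (2 * t) * (norm_R R k)\<^sup>2) ` range R)"
proof -
  obtain M where M: "\<And>y. \<bar>f y\<bar> \<le> M"
    using assms(1) by (auto simp: bounded_iff)
  have "- M \<le> f (x + k - h) + 1 / (2 * t) * (norm_R R k)\<^sup>2" for k
  proof -
    have "0 \<le> 1 / (2 * t) * (norm_R R k)\<^sup>2" using assms(2) by simp
    with M[of "x + k - h"] show ?thesis by linarith
  qed
  then show ?thesis by (intro bdd_belowI2)
qed

lemma lasry_lions_bdd_above:
  assumes "bounded (range f)" "t > 0"
  shows "bdd_above
    ((\<lambda>h. (INF k\<in>range R. f (x + k - h) + 1 / (2 * t) * (norm_R R k)\<^sup>2)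
           - 1 / t * (norm_R R h)\<^sup>2) ` range R)"
proof -
  obtain M where M: "\<And>y. \<bar>f y\<bar> \<le> M"
    using assms(1) by (auto simp: bounded_iff)
  let ?k = "R 0"
  let ?C = "M + 1 / (2 * t) * (norm_R R ?k)\<^sup>2"
  have "(INF k\<in>range R. f (x + k - h) + 1 / (2 * t) * (norm_R R k)\<^sup>2)
           - 1 / t * (norm_R R h)\<^sup>2 \<le> ?C" for h
  proof -
    have "(INF k\<in>range R. f (x + k - h) + 1 / (2 * t) * (norm_R R k)\<^sup>2)
        \<le> f (x + ?k - h) + 1 / (2 * t) * (norm_R R ?k)\<^sup>2"
      by (rule cINF_lower[OF lasry_lions_bdd_below[OF assms]]) simp
    moreover have "0 \<le> 1 / t * (norm_R R h)\<^sup>2" using assms(2) by simp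
    ultimately show ?thesis using M[of "x + ?k - h"] by linarith
  qed
  then show ?thesis by (intro bdd_aboveI2)
qed

end

theory Submission
  imports Defs
begin

text \<open>The operator \<open>f \<mapsto> S\<^sup>R(t) f\<close> is built from \<open>f\<close> by translating, adding terms that do not
  depend on \<open>f\<close> or \<open>x\<close>, and taking an infimum and a supremum. Each of these operations is
  nonexpansive for the uniform distance and commutes with translations of \<open>H\<close>, so the same is
  true of \<open>S\<^sup>R(t)\<close>. Comparing \<open>f\<close> with its own translates shows that every modulus of
  continuity of \<open>f\<close> is one of \<open>S\<^sup>R(t) f\<close>; comparing \<open>f\<close> with \<open>0\<close>, for which
  \<open>S\<^sup>R(t) 0\<close> is constant, shows boundedness. Lemma \<open>lasry_lions_nonexpansive\<close> combines
  nonexpansiveness and translation invariance in one estimate.\<close>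

lemma cSUP_diff_abs_le:
  fixes u v :: "'b \<Rightarrow> real"
  assumes "A \<noteq> {}" "bdd_above (u ` A)" "bdd_above (v ` A)"
    and close: "\<And>k. k \<in> A \<Longrightarrow> \<bar>u k - v k\<bar> \<le> e"
  shows "\<bar>(SUP k\<in>A. u k) - (SUP k\<in>A. v k)\<bar> \<le> e"
proof -
  have "(SUP k\<in>A. u k) \<le> (SUP k\<in>A. v k) + e"
  proof (rule cSUP_least[OF assms(1)])
    fix k assume k: "k \<in> A"
    show "u k \<le> (SUP k\<in>A. v k) + e"
      using close[OF k] cSUP_upper[OF k assms(3)] by linarith
  qed
  moreover have "(SUP k\<in>A. v k) \<le> (SUP k\<in>A. u k) + e"
  proof (rule cSUP_least[OF assms(1)])
    fix k assume k: "k \<in> A"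
    show "v k \<le> (SUP k\<in>A. u k) + e"
      using close[OF k] cSUP_upper[OF k assms(2)] by linarith
  qed
  ultimately show ?thesis by linarith
qed

lemma cINF_diff_abs_le:
  fixes u v :: "'b \<Rightarrow> real"
  assumes "A \<noteq> {}" "bdd_below (u ` A)" "bdd_below (v ` A)"
    and close: "\<And>k. k \<in> A \<Longrightarrow> \<bar>u k - v k\<bar> \<le> e"
  shows "\<bar>(INF k\<in>A. u k) - (INF k\<in>A. v k)\<bar> \<le> e"
proof -
  have "(INF k\<in>A. u k) - e \<le> (INF k\<in>A. v k)"
  proof (rule cINF_greatest[OF assms(1)])
    fix k assume k: "k \<in> A"
    show "(INF k\<in>A. u k) - e \<le> v k"
      using close[OF k] cINF_lower[OF assms(2) k] by linarith
  qed
  moreover have "(INF k\<in>A. v k) - e \<le> (INF k\<in>A. u k)"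
  proof (rule cINF_greatest[OF assms(1)])
    fix k assume k: "k \<in> A"
    show "(INF k\<in>A. v k) - e \<le> u k"
      using close[OF k] cINF_lower[OF assms(3) k] by linarith
  qed
  ultimately show ?thesis by linarith
qed

text \<open>The value at \<open>x\<close> depends on \<open>f\<close> only through its translate \<open>z \<mapsto> f (x + z)\<close>. Allowing two
  functions and two base points covers both uses: \<open>g = f\<close> for the modulus of continuity, and
  \<open>g = 0\<close> for the bound.\<close>

lemma lasry_lions_nonexpansive:
  fixes f g :: "'a::real_inner \<Rightarrow> real"
  assumes f: "bounded (range f)" and g: "bounded (range g)" and t: "t > 0"
    and close: "\<And>z. \<bar>f (x + z) - g (y + z)\<bar> \<le> e"
  shows "\<bar>lasry_lions R t f x - lasry_lions R t g y\<bar> \<le> e"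
proof -
  let ?I = "\<lambda>f x h. INF k\<in>range R. f (x + k - h) + 1 / (2 * t) * (norm_R R k)\<^sup>2"
  have inner: "\<bar>?I f x h - ?I g y h\<bar> \<le> e" for h
  proof (rule cINF_diff_abs_le[OF _ lasry_lions_bdd_below[OF f t]
        lasry_lions_bdd_below[OF g t]])
    fix k
    show "\<bar>f (x + k - h) + 1 / (2 * t) * (norm_R R k)\<^sup>2 -
        (g (y + k - h) + 1 / (2 * t) * (norm_R R k)\<^sup>2)\<bar> \<le> e"
      using close[of "k - h"] by (simp add: add_diff_eq)
  qed simp
  show ?thesis
    unfolding lasry_lions_def
  proof (rule cSUP_diff_abs_le[OF _ lasry_lions_bdd_above[OF f t]
        lasry_lions_bdd_above[OF g t]])
    fix h
    show "\<bar>(?I f x h - 1 / t * (norm_R R h)\<^sup>2) - (?I g y h - 1 / t * (norm_R R h)\<^sup>2)\<bar> \<le> e"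
      using inner[of h] by linarith
  qed simp
qed

theorem proposition4p11:
  fixes R :: "'a::{real_inner, complete_space} \<Rightarrow> 'a"
    and f :: "'a \<Rightarrow> real" and t :: real
  assumes "separable_space (euclidean :: 'a topology)"
    and "bounded_linear R" and "self_adjoint R"
    and "f \<in> BUC" and "t > 0"
  shows "(\<lambda>x. lasry_lions R t f x) \<in> BUC"
proof -
  have bdd: "bounded (range f)" and uc: "uniformly_continuous_on UNIV f"
    using assms(4) by (auto simp: BUC_def)
  obtain M where M: "\<And>y. \<bar>f y\<bar> \<le> M"
    using bdd by (auto simp: bounded_iff)
  have "bounded (range (\<lambda>x. lasry_lions R t f x))"
  proof -
    let ?c = "lasry_lions R t (\<lambda>_. 0) 0"
    have "\<bar>lasry_lions R t f x - ?c\<bar> \<le> M" for x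
      by (rule lasry_lions_nonexpansive[OF bdd _ assms(5)]) (simp_all add: M)
    then have "dist ?c (lasry_lions R t f x) \<le> M" for x
      by (simp add: dist_real_def abs_minus_commute)
    then show ?thesis
      unfolding bounded_def by blast
  qed
  moreover have "uniformly_continuous_on UNIV (\<lambda>x. lasry_lions R t f x)"
    unfolding uniformly_continuous_on_def
  proof (intro allI impI)
    fix e :: real assume "e > 0"
    \<comment> \<open>The supremum and the infimum preserve only weak inequalities, hence \<open>e / 2\<close>.\<close>
    then have "e / 2 > 0" by simp
    then obtain d where "d > 0" and d: "\<And>y y'. dist y' y < d \<Longrightarrow> dist (f y') (f y) < e / 2"
      using uc unfolding uniformly_continuous_on_def by blast
    have "dist (lasry_lions R t f x') (lasry_lions R t f x) < e" if "dist x' x < d" for x x'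
    proof -
      have "\<bar>lasry_lions R t f x' - lasry_lions R t f x\<bar> \<le> e / 2"
      proof (rule lasry_lions_nonexpansive[OF bdd bdd assms(5)])
        fix z
        have "dist (x' + z) (x + z) < d" using that by simp
        then show "\<bar>f (x' + z) - f (x + z)\<bar> \<le> e / 2"
          using d by (fastforce simp: dist_real_def)
      qed
      then show ?thesis using \<open>e > 0\<close> by (simp add: dist_real_def)
    qed
    then show "\<exists>d>0. \<forall>x\<in>UNIV. \<forall>x'\<in>UNIV. dist x' x < d \<longrightarrow>
        dist (lasry_lions R t f x') (lasry_lions R t f x) < e"
      using \<open>d > 0\<close> by blast
  qed
  ultimately show ?thesis by (simp add: BUC_def)
qed

end
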